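(* Let $(X,d)$ be a metric space, let $U\subset X$ be a path-connected subset, and let $M\subset\operatorname{int}(U)$ be a closed (in $X$), countably infinite set such that $\operatorname{iso}(M)=M$. If $U$ satisfies the $(U\text{-}M)$ property, and if for every $x\in X$ and every $\delta>0$ the boundary $\partial B_d(x,\delta)$ of the open ball $B_d(x,\delta)$ is a non-empty and path-connected set, then the set $U\setminus M$ is also path-connected.
   Context: For a metric space $(X,d)$, $x\in X$ and $\delta>0$, $B_d(x,\delta):=\{z\in X: d(z,x)<\delta\}$. For $A\subset X$, $\operatorname{int}(A)$ is the topological interior of $A$, $\overline{A}$ its closure, $\partial A:=\overline{A}\cap\overline{X\setminus A}$ its topological boundary, and $\operatorname{iso}(A):=\{x\in X:\ \exists\,\delta_x>0,\ B_d(x,\delta_x)\cap A=\{x\}\}$ its set of isolated points. A metric space $(Y,\rho)$ is path-connected if for every $x,y\in Y$ with $x\neq y$ there exist an interval $I\subset\mathbb{R}$ and a continuous map $\gamma:I\to Y$ with $x,y\in\gamma(I)$ (with this definition the empty space is path-connected). A subset $A\subset X$ is path-connected if it is path-connected as a metric subspace. $(U\text{-}M)$ property: let $U$ be a path-connected subset of $X$ and $M\subset U$. The set $U$ satisfies the $(U\text{-}M)$ property if and only if the following holds for all $x,y\in U\setminus M$ and all $\tilde{x}\in M$: whenever $\gamma:I\to U$ is a path (a continuous map on an interval $I\subset\mathbb{R}$) that connects the points $x,y$, and $(x_j)_{j\in\mathbb{N}}$ is a sequence of pairwise distinct points of $M$ for which there exists $z\in\{x_j: j\in\mathbb{N}\}\setminus\{\tilde{x}\}$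 with $$\operatorname{dist}\bigl(\tilde{x},\{x_j: j\in\mathbb{N}\}\setminus\{\tilde{x}\}\bigr)=d(\tilde{x},z),$$ then (for such $z$) there exists a continuous map $\gamma^*_{z,\tilde{x}}:[t_z,t_{\tilde{x}}]\to U$, defined on a compact interval with endpoints $t_z<t_{\tilde x}$ in $\mathbb{R}$, such that $\gamma^*_{z,\tilde{x}}(t_z)=z$, $\gamma^*_{z,\tilde{x}}(t_{\tilde{x}})=\tilde{x}$ and $\gamma^*_{z,\tilde{x}}\bigl((t_z,t_{\tilde{x}})\bigr)\cap M=\emptyset$. Here $\operatorname{dist}(p,A):=\inf\{d(p,a): a\in A\}$. *)

theory Defs
  imports "HOL-Analysis.Analysis"
begin

text \<open>A path is parametrised by an arbitrary real interval, which need be neither compact nor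
  of the form \<open>[0,1]\<close>; connecting \<open>x\<close> and \<open>y\<close> means passing through both points.\<close>

definition connecting_path ::
    "'a::topological_space set \<Rightarrow> real set \<Rightarrow> (real \<Rightarrow> 'a) \<Rightarrow> 'a \<Rightarrow> 'a \<Rightarrow> bool" where
  "connecting_path U I \<gamma> x y \<longleftrightarrow>
     is_interval I \<and> continuous_on I \<gamma> \<and> \<gamma> ` I \<subseteq> U \<and> x \<in> \<gamma> ` I \<and> y \<in> \<gamma> ` I"

text \<open>Sequences of pairwise distinct points are injective functions on \<^typ>\<open>nat\<close>; hence the set
  to which the distance is taken is never empty. The property is only meant for path-connected \<open>U\<close>
  and \<open>M \<subseteq> U\<close>, which are not part of the predicate.\<close>

definition UM_property :: "'a::metric_space set \<Rightarrow> 'a set \<Rightarrow> bool" where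
  "UM_property U M \<longleftrightarrow>
     (\<forall>x \<in> U - M. \<forall>y \<in> U - M. \<forall>x' \<in> M. \<forall>I \<gamma>. \<forall>xs :: nat \<Rightarrow> 'a. \<forall>z.
        connecting_path U I \<gamma> x y \<longrightarrow>
        inj xs \<longrightarrow> range xs \<subseteq> M \<longrightarrow>
        z \<in> range xs - {x'} \<longrightarrow>
        infdist x' (range xs - {x'}) = dist x' z \<longrightarrow>
        (\<exists>(tz :: real) tx \<gamma>'. tz < tx \<and> continuous_on {tz..tx} \<gamma>' \<and> \<gamma>' ` {tz..tx} \<subseteq> U \<and>
           \<gamma>' tz = z \<and> \<gamma>' tx = x' \<and> \<gamma>' ` {tz<..<tx} \<inter> M = {}))"

text \<open>The library notions of path-connectedness and isolated point agree with the ones phrased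
  through arbitrary intervals and through balls.\<close>

lemma path_connected_iff_connecting_path:
  "path_connected S \<longleftrightarrow>
     (\<forall>x \<in> S. \<forall>y \<in> S. x \<noteq> y \<longrightarrow> (\<exists>I \<gamma>. connecting_path S I \<gamma> x y))"
proof
  assume S: "path_connected S"
  show "\<forall>x \<in> S. \<forall>y \<in> S. x \<noteq> y \<longrightarrow> (\<exists>I \<gamma>. connecting_path S I \<gamma> x y)"
  proof (intro ballI impI)
    fix x y assume "x \<in> S" "y \<in> S"
    then obtain g where g: "path g" "path_image g \<subseteq> S" "pathstart g = x" "pathfinish g = y"
      using S unfolding path_connected_def by blast
    have "connecting_path S {0..1} g x y"
      using g pathstart_in_path_image[of g] pathfinish_in_path_image[of g]
      by (auto simp: connecting_path_def path_def path_image_def is_interval_cc)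
    then show "\<exists>I \<gamma>. connecting_path S I \<gamma> x y" by blast
  qed
next
  assume R: "\<forall>x \<in> S. \<forall>y \<in> S. x \<noteq> y \<longrightarrow> (\<exists>I \<gamma>. connecting_path S I \<gamma> x y)"
  show "path_connected S"
    unfolding path_connected_component
  proof (intro ballI)
    fix x y assume xy: "x \<in> S" "y \<in> S"
    show "path_component S x y"
    proof (cases "x = y")
      case True
      then show ?thesis using xy by (simp add: path_component_refl)
    next
      case False
      then obtain I \<gamma> where c: "connecting_path S I \<gamma> x y" using R xy by blast
      then have "path_connected (\<gamma> ` I)"
        by (intro path_connected_continuous_image)
           (auto simp: connecting_path_def is_interval_path_connected)
      then have "path_component (\<gamma> ` I) x y"
        using c unfolding connecting_path_def path_connected_component by blast
      then show ?thesis
        using c path_component_of_subset by (auto simp: connecting_path_def)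
    qed
  qed
qed

lemma isolated_in_iff_ball:
  fixes x :: "'a::metric_space"
  shows "x isolated_in A \<longleftrightarrow> (\<exists>\<delta>>0. ball x \<delta> \<inter> A = {x})"
  unfolding isolated_in_dist_Ex_iff by (force simp: set_eq_iff)

end

theory Submission
  imports Defs
begin

text \<open>A path in \<open>U\<close> meets the closed discrete set \<open>M\<close> in finitely many points, which can be avoided
  one after the other: around such a point choose a ball so small that its boundary lies in
  \<open>U - M\<close>; the path has to hit this boundary before it first reaches the point and after
  it last leaves it, and the two hitting points can be joined inside the boundary.\<close>

text \<open>A path from \<open>x\<close> to \<open>m\<close> is cut at the first time
  \<open>u\<close> at which it is not in the interior of \<open>- N\<close>. As \<open>N\<close> is
  open, it misses its frontier, so the piece up to and including time \<open>u\<close> stays in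
  \<open>S - N\<close>.\<close>

lemma path_component_frontierE:
  fixes S N :: "'a::metric_space set"
  assumes "path_component S x m" "open N" "m \<in> N" "x \<notin> N"
  obtains p where "p \<in> frontier N" "path_component (S - N) x p"
proof -
  obtain g where g: "path g" "path_image g \<subseteq> S" "pathstart g = x" "pathfinish g = m"
    using assms(1) unfolding path_component_def by blast
  have x: "g 0 = x" and m: "pathfinish g \<notin> - N"
    using g assms(3) by (auto simp: pathstart_def)
  obtain u where u: "0 \<le> u" "u \<le> 1" "\<And>t. 0 \<le> t \<and> t < u \<Longrightarrow> g t \<in> interior (- N)"
    "g u \<notin> interior (- N)" "u = 0 \<or> g u \<in> closure (- N)"
    using subpath_to_frontier_explicit[OF g(1) m] by blast
  \<comment> \<open>For \<open>u = 0\<close> the point is \<open>x\<close>, which lies in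
    \<open>- N\<close> itself.\<close>
  have "g u \<in> closure (- N)"
    using u(5) x assms(4) closure_subset[of "- N"] by auto
  then have fr: "g u \<in> frontier N"
    using u(4) by (metis DiffI frontier_complement frontier_def)
  then have "g u \<notin> N"
    using \<open>open N\<close> frontier_disjoint_eq[of N] by blast
  have "g t \<in> S - N" if "t \<in> {0..u}" for t
  proof (cases "t = u")
    case True
    then show ?thesis
      using \<open>g u \<notin> N\<close> g(2) u(1,2) by (auto simp: path_image_def)
  next
    case False
    then have "g t \<in> - N"
      using that u(3)[of t] interior_subset[of "- N"] by auto
    then show ?thesis
      using that u(2) g(2) by (auto simp: path_image_def)
  qed
  then have "g ` {0..u} \<subseteq> S - N"
    by blast
  moreover have "path_connected (g ` {0..u})"
    using g(1) u(2) by (intro path_connected_continuous_image)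
      (auto simp: path_def is_interval_path_connected is_interval_cc intro: continuous_on_subset)
  moreover have "x \<in> g ` {0..u}" "g u \<in> g ` {0..u}"
    using u(1) x by force+
  ultimately have "path_component (S - N) x (g u)"
    unfolding path_connected_component using path_component_of_subset by blast
  then show thesis
    using fr that by blast
qed

text \<open>If \<open>m\<close> can be reached from \<open>x\<close> inside \<open>S\<close>, it can
  also be reached from \<open>y\<close>; a path from each of them to \<open>m\<close> is cut at the
  frontier of \<open>N\<close>, and the frontier joins the two cut points. Starting afresh from
  \<open>y\<close> turns the last exit into a first hit.\<close>

lemma path_component_detour:
  fixes S N :: "'a::metric_space set"
  assumes xy: "path_component S x y"
    and N: "open N" "m \<in> N" "x \<notin> N" "y \<notin> N"
    and fr: "frontier N \<subseteq> S" "path_connected (frontier N)"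
  shows "path_component (S - {m}) x y"
proof (cases "path_component S x m")
  case True
  then have "path_component S y m"
    using xy path_component_sym path_component_trans by blast
  then obtain q where q: "q \<in> frontier N" "path_component (S - N) y q"
    using path_component_frontierE[OF _ N(1,2,4)] by blast
  obtain p where p: "p \<in> frontier N" "path_component (S - N) x p"
    using path_component_frontierE[OF True N(1-3)] by blast
  \<comment> \<open>The open set \<open>N\<close> contains \<open>m\<close> and misses its own
    frontier, so all three pieces of the detour avoid \<open>m\<close>.\<close>
  have sub: "S - N \<subseteq> S - {m}" "frontier N \<subseteq> S - {m}"
    using N(1,2) fr(1) frontier_disjoint_eq[of N] by blast+
  have "path_component (S - {m}) p q"
    using fr(2) p(1) q(1) sub(2) path_component_of_subset
    unfolding path_connected_component by blast
  then show ?thesis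
    using p(2) q(2) sub(1) path_component_of_subset path_component_sym path_component_trans
    by meson
next
  case False
  obtain g where g: "path g" "path_image g \<subseteq> S" "pathstart g = x" "pathfinish g = y"
    using xy unfolding path_component_def by blast
  \<comment> \<open>Every point on the path is reachable from \<open>x\<close>, so \<open>m\<close>
    is not on it.\<close>
  have "path_component S x z" if "z \<in> path_image g" for z
    using path_component_path_image_pathstart[OF g(1) that] g(2,3) path_component_of_subset
    by blast
  then have "path_image g \<subseteq> S - {m}"
    using False g(2) by blast
  then show ?thesis
    using g unfolding path_component_def by blast
qed

text \<open>Induction removes one point at a time. Since the frontiers lie in \<open>S\<close> and
  not just in \<open>S \<union> F\<close>, they remain available while \<open>F\<close>
  shrinks.\<close>

lemma path_component_finite_detour:
  fixes S F :: "'a::metric_space set"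
  assumes "finite F" "path_component (S \<union> F) x y" "x \<in> S" "y \<in> S"
    and "\<And>m. m \<in> F \<Longrightarrow> \<exists>N. open N \<and> m \<in> N \<and> x \<notin> N \<and> y \<notin> N \<and>
            frontier N \<subseteq> S \<and> path_connected (frontier N)"
  shows "path_component S x y"
  using assms
proof (induction F rule: finite_induct)
  case empty
  then show ?case by simp
next
  case (insert m F)
  then obtain N where N: "open N" "m \<in> N" "x \<notin> N" "y \<notin> N"
      "frontier N \<subseteq> S" "path_connected (frontier N)"
    by blast
  have "path_component (S \<union> insert m F - {m}) x y"
    using path_component_detour[OF insert.prems(1) N(1-4) _ N(6)] N(5) by blast
  then have "path_component (S \<union> F) x y"
    by (rule path_component_of_subset[rotated]) auto
  then show ?case
    using insert by blast
qed

lemma frontier_ball_subset_sphere: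
  fixes x :: "'a::metric_space"
  shows "frontier (ball x r) \<subseteq> sphere x r"
  using closure_minimal[OF ball_subset_cball closed_cball, of x r] by (auto simp: frontier_def)

theorem theorem2p3:
  fixes U M :: "'a::metric_space set"
  assumes "path_connected U"
    and "M \<subseteq> interior U"
    and "closed M"
    and "countable M"
    and "infinite M"
    and "{x. x isolated_in M} = M"
    and "UM_property U M"
    and "\<And>(x::'a) \<delta>::real. \<delta> > 0 \<Longrightarrow>
           frontier (ball x \<delta>) \<noteq> {} \<and> path_connected (frontier (ball x \<delta>))"
  shows "path_connected (U - M)"
  unfolding path_connected_component
proof (intro ballI)
  fix x y assume x: "x \<in> U - M" and y: "y \<in> U - M"
  then obtain g where g: "path g" "path_image g \<subseteq> U" "pathstart g = x" "pathfinish g = y"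
    using assms(1) unfolding path_connected_def by blast
  \<comment> \<open>A limit point of \<open>M\<close> would belong to the closed set
    \<open>M\<close>, whose points are all isolated. Hence a compact path image meets
    \<open>M\<close> in a finite set.\<close>
  have lim: "\<not> z islimpt M" for z
    using assms(3,6) closed_limpt[of M] by (auto simp: isolated_in_islimpt_iff)
  let ?F = "path_image g \<inter> M"
  show "path_component (U - M) x y"
  proof (rule path_component_finite_detour)
    show "finite ?F"
      using lim by (intro finite_not_islimpt_in_compact compact_path_image g(1))
    show "path_component (U - M \<union> ?F) x y"
      using g unfolding path_component_def by blast
  next
    fix m assume "m \<in> ?F"
    then have m: "m \<in> M" "m \<in> interior U" "m \<noteq> x" "m \<noteq> y"
      using assms(2) x y by auto
    obtain d where d: "d > 0" "\<And>z. z \<in> M \<Longrightarrow> dist m z < d \<Longrightarrow> z = m"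
      using m(1) assms(6) isolated_inE_dist by blast
    obtain e where e: "e > 0" "cball m e \<subseteq> U"
      using m(2) unfolding mem_interior_cball by blast
    \<comment> \<open>Halving \<open>d\<close> makes \<open>r < d\<close>, so the sphere misses
      \<open>M\<close>; the bound \<open>e\<close> keeps it in \<open>U\<close>. The last two bounds
      keep \<open>x\<close> and \<open>y\<close> out of the ball, where equality is harmless because
      the ball is open.\<close>
    define r where "r = Min {d / 2, e, dist m x, dist m y}"
    have r: "0 < r" "r < d" "r \<le> e" "r \<le> dist m x" "r \<le> dist m y"
      using d(1) e(1) m(3,4) by (auto simp: r_def min_def)
    have "sphere m r \<subseteq> U - M"
      using d(2) e(2) r by (fastforce simp: subset_iff)
    then have "frontier (ball m r) \<subseteq> U - M"
      using frontier_ball_subset_sphere by blast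
    moreover have "path_connected (frontier (ball m r))"
      using assms(8) r(1) by blast
    ultimately show "\<exists>N. open N \<and> m \<in> N \<and> x \<notin> N \<and> y \<notin> N \<and>
        frontier N \<subseteq> U - M \<and> path_connected (frontier N)"
      using r by (intro exI[of _ "ball m r"]) auto
  qed (use x y in auto)
qed

end
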